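(* Let $\mathbb{W}$ be an $m$-dimensional subspace of $\ell_\infty^n$ and let $\mathcal{A}=\{\widetilde{a_1},\ldots,\widetilde{a_m}\}$ be a basis of $\mathbb{W}$. Suppose that the number of nonequivalent components of $\mathcal{A}$ satisfying the $*$-Property is $r$. Then: (i) the number of facets of $B_{\mathbb{W}}$ is $2r$; (ii) for $s\in\mathbb{N}$, $\mathbb{W}$ can be (linearly isometrically) embedded into $\ell_\infty^s$ if and only if $r\le s$; (iii) $\mathbb{W}$ is isometrically isomorphic to $\ell_\infty^m$ if and only if $r=m$.
   Context: All spaces are over $\mathbb{R}$; $\ell_\infty^n$ is $\mathbb{R}^n$ with the maximum norm and $B_{\mathbb{X}}$ is the closed unit ball of $\mathbb{X}$. Components. Let $\mathcal{A}=\{\widetilde{a_1},\ldots,\widetilde{a_m}\}\subset\ell_\infty^n$ be linearly independent, $\widetilde{a_k}=(a_1^k,\ldots,a_n^k)$. For $1\le i\le n$, the $i$-th component of $\mathcal{A}$ is $(a_i^1,a_i^2,\ldots,a_i^m)\in\mathbb{R}^m$. Two components are equivalent if they are equal up to sign; let $E_i=\{j\in\{1,\ldots,n\}:(a_j^1,\ldots,a_j^m)=\pm(a_i^1,\ldots,a_i^m)\}$. The $i$-th component satisfies the $*$-Property if there is $(\beta_1,\ldots,\beta_m)\in\mathbb{R}^m$ such that $|\sum_{k=1}^m\beta_ka_i^k|>\max\{|\sum_{k=1}^m\beta_ka_j^k|:j\in\{1,\ldots,n\}\setminus E_i\}$ (the condition is vacuous if $E_i=\{1,\ldots,n\}$).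 "The number of nonequivalent components satisfying the $*$-Property" is the number of equivalence classes of components satisfying it. Facets. For a finite-dimensional Banach space $\mathbb{X}$, a proper face of $B_{\mathbb{X}}$ is a non-empty set of the form $B_{\mathbb{X}}\cap\delta M$, where $M$ is a closed half-space containing $B_{\mathbb{X}}$ and $\delta M$ is its boundary; $B_{\mathbb{X}}$ itself is also called a face. A facet of $B_{\mathbb{X}}$ is a proper face that is maximal under inclusion among proper faces. *)

theory Defs
  imports "HOL-Analysis.Analysis"
begin

text \<open>
  The space l_infinity^n is the type \<open>real ^ 'n\<close> with \<open>n = CARD('n)\<close>, normed by the library's
  \<open>infnorm\<close> (the maximum of the absolute values of the coordinates, see \<open>infnorm_cart\<close>) and not
  by the Euclidean \<open>norm\<close>.  A subspace \<open>W\<close> carries the restriction of \<open>infnorm\<close>.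
\<close>

definition unit_ball_max :: "(real ^ 'n::finite) set \<Rightarrow> (real ^ 'n) set"
  where "unit_ball_max W = {x \<in> W. infnorm x \<le> 1}"

definition linear_map_on :: "'a::real_vector set \<Rightarrow> ('a \<Rightarrow> 'b::real_vector) \<Rightarrow> bool"
  where "linear_map_on W f \<longleftrightarrow>
    (\<forall>x\<in>W. \<forall>y\<in>W. f (x + y) = f x + f y) \<and> (\<forall>c. \<forall>x\<in>W. f (c *\<^sub>R x) = c *\<^sub>R f x)"

definition linear_isometry_on ::
    "(real ^ 'n::finite) set \<Rightarrow> (real ^ 'n \<Rightarrow> real ^ 's::finite) \<Rightarrow> bool"
  where "linear_isometry_on W f \<longleftrightarrow>
    linear_map_on W f \<and> (\<forall>x\<in>W. infnorm (f x) = infnorm x)"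

definition embeds_linf :: "(real ^ 'n::finite) set \<Rightarrow> 's::finite itself \<Rightarrow> bool"
  where "embeds_linf W s \<longleftrightarrow> (\<exists>f :: real ^ 'n \<Rightarrow> real ^ 's. linear_isometry_on W f)"

definition isometric_linf :: "(real ^ 'n::finite) set \<Rightarrow> 's::finite itself \<Rightarrow> bool"
  where "isometric_linf W s \<longleftrightarrow>
    (\<exists>f :: real ^ 'n \<Rightarrow> real ^ 's. linear_isometry_on W f \<and> f ` W = UNIV)"

text \<open>
  Faces are taken inside the normed space \<open>W\<close> itself: a closed half-space of \<open>W\<close> is
  \<open>M = {x \<in> W. f x \<le> c}\<close> for a linear functional \<open>f\<close> on \<open>W\<close> that is not identically zero on \<open>W\<close>,
  and its boundary is \<open>{x \<in> W. f x = c}\<close>.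
\<close>

definition proper_face :: "(real ^ 'n::finite) set \<Rightarrow> (real ^ 'n) set \<Rightarrow> bool"
  where "proper_face W F \<longleftrightarrow> F \<noteq> {} \<and>
    (\<exists>(f :: real ^ 'n \<Rightarrow> real) c. linear_map_on W f \<and> (\<exists>x\<in>W. f x \<noteq> 0) \<and>
       unit_ball_max W \<subseteq> {x \<in> W. f x \<le> c} \<and>
       F = unit_ball_max W \<inter> {x \<in> W. f x = c})"

definition facet :: "(real ^ 'n::finite) set \<Rightarrow> (real ^ 'n) set \<Rightarrow> bool"
  where "facet W F \<longleftrightarrow> proper_face W F \<and> (\<forall>G. proper_face W G \<and> F \<subseteq> G \<longrightarrow> G = F)"

text \<open>A family of \<open>m = CARD('m)\<close> vectors is a function \<open>a\<close> on \<open>'m\<close>.\<close>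

definition component :: "('m::finite \<Rightarrow> real ^ 'n::finite) \<Rightarrow> 'n \<Rightarrow> real ^ 'm"
  where "component a i = (\<chi> k. a k $ i)"

definition equiv_components :: "('m::finite \<Rightarrow> real ^ 'n::finite) \<Rightarrow> 'n \<Rightarrow> 'n set"
  where "equiv_components a i =
    {j. component a j = component a i \<or> component a j = - component a i}"

text \<open>
  The strict inequality against the maximum over \<open>j \<notin> E\<^sub>i\<close> is written as a bounded quantifier, so
  that it is vacuous when \<open>E\<^sub>i\<close> is the whole index set.
\<close>

definition star_property :: "('m::finite \<Rightarrow> real ^ 'n::finite) \<Rightarrow> 'n \<Rightarrow> bool"
  where "star_property a i \<longleftrightarrow>
    (\<exists>\<beta> :: real ^ 'm. \<forall>j \<in> UNIV - equiv_components a i.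
       \<bar>\<Sum>k\<in>UNIV. \<beta> $ k * a k $ i\<bar> > \<bar>\<Sum>k\<in>UNIV. \<beta> $ k * a k $ j\<bar>)"

definition num_star_components :: "('m::finite \<Rightarrow> real ^ 'n::finite) \<Rightarrow> nat"
  where "num_star_components a = card (equiv_components a ` {i. star_property a i})"

end

theory Submission
  imports Defs
begin

text \<open>
  Expanding \<open>x \<in> W\<close> in the basis \<open>a\<close> shows that the linear form given by the \<open>i\<close>-th component of
  \<open>a\<close> is just the coordinate \<open>x \<mapsto> x $ i\<close> on \<open>W\<close>.  So two components are equivalent iff the two
  coordinates agree up to a global sign on \<open>W\<close>, and the \<open>*\<close>-property says that some \<open>x \<in> W\<close> has
  its coordinates of largest absolute value only at \<open>i\<close> and at the coordinates equivalent to \<open>i\<close>;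
  such a coordinate \<open>i\<close> is called peaking.  In the dual space, the unit ball is the convex hull of the coordinate forms and
  their negatives, and the peaking coordinates are the exposed points of this polytope.  The proof
  replaces this duality by three direct arguments.

  \<^item> The peaking coordinates alone determine the norm of \<open>W\<close> (\<open>norm_attained_at_peaking\<close>).  If the
    norm of \<open>x\<close> is attained at inequivalent coordinates, a small perturbation inside \<open>W\<close> separates
    their absolute values and creates no new maximal coordinate.  This process stops at a vector
    whose maximal coordinates are all equivalent, hence peaking.

  \<^item> Every proper face of the unit ball lies in a face \<open>\<sigma> x $ i = 1\<close> with \<open>i\<close> peaking
    (\<open>proper_face_subset_peak_face\<close>), because a point of the face with the fewest maximal
    coordinates has those coordinates in common with every other point of the face.  No two distinct
    faces of this kind are nested, since a unit vector peaking at \<open>i\<close> lies in just one of them.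
    So they are the facets, two for each class of peaking coordinates.

  \<^item> Let \<open>x\<close> be a peaking vector for \<open>i\<close> with \<open>x $ i = infnorm x = 1\<close>.  Near \<open>x\<close> the norm of \<open>W\<close>
    is the linear form \<open>y \<mapsto> y $ i\<close>, so a form bounded by the norm with value \<open>1\<close> at \<open>x\<close> is
    that coordinate (\<open>functional_eq_coordinate_at_peak\<close>).  Under an isometric embedding into
    \<open>l_infinity^s\<close>, each class of peaking coordinates is therefore, up to sign, one of the \<open>s\<close>
    target coordinates, which gives \<open>r \<le> s\<close>.  Conversely, if \<open>r \<le> s\<close>, keeping one coordinate of
    each peaking class and padding with zeros is an isometry by the first point.

  For \<open>s = m = dim W\<close> the map that keeps one coordinate of each class is injective between spaces of equal
  dimension, hence onto; it can then have no padding coordinate.  So an embedding into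
  \<open>l_infinity^m\<close> exists only if \<open>r = m\<close>, and for \<open>r = m\<close> this map is an isometric isomorphism.
\<close>

section \<open>Coordinates of the maximum norm\<close>

lemma infnorm_le_iff_coordinates:
  fixes x :: "real ^ 'n::finite"
  shows "infnorm x \<le> c \<longleftrightarrow> (\<forall>j. \<bar>x $ j\<bar> \<le> c)"
proof
  assume "infnorm x \<le> c"
  then show "\<forall>j. \<bar>x $ j\<bar> \<le> c"
    using component_le_infnorm_cart order_trans by blast
next
  assume "\<forall>j. \<bar>x $ j\<bar> \<le> c"
  then show "infnorm x \<le> c"
    unfolding infnorm_cart by (intro cSup_least) auto
qed

lemma infnorm_attained:
  fixes x :: "real ^ 'n::finite"
  shows "\<exists>j. \<bar>x $ j\<bar> = infnorm x"
proof -
  have "Sup (range (\<lambda>j. \<bar>x $ j\<bar>)) \<in> range (\<lambda>j. \<bar>x $ j\<bar>)"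
    using Max_in[of "range (\<lambda>j. \<bar>x $ j\<bar>)"] by (simp add: cSup_eq_Max)
  then show ?thesis
    unfolding infnorm_cart by (auto simp: full_SetCompr_eq)
qed

definition active :: "real ^ 'n::finite \<Rightarrow> 'n set"
  where "active x = {j. \<bar>x $ j\<bar> = infnorm x}"

lemma active_nonempty: "active x \<noteq> {}"
  using infnorm_attained unfolding active_def by auto

lemma not_active_less: "j \<notin> active x \<Longrightarrow> \<bar>x $ j\<bar> < infnorm x"
  using component_le_infnorm_cart[of x j] unfolding active_def by auto

text \<open>
  Equivalence of components and the \<open>*\<close>-property, phrased on \<open>W\<close> without a basis; the translation
  is \<open>equiv_components_eq\<close> and \<open>star_property_iff_peaking\<close>.
\<close>

definition coord_equiv :: "(real ^ 'n::finite) set \<Rightarrow> 'n \<Rightarrow> 'n \<Rightarrow> bool"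
  where "coord_equiv W i j \<longleftrightarrow> (\<exists>\<rho>\<in>{1, -1}. \<forall>x\<in>W. x $ j = \<rho> * x $ i)"

definition peaking :: "(real ^ 'n::finite) set \<Rightarrow> 'n \<Rightarrow> bool"
  where "peaking W i \<longleftrightarrow> (\<exists>x\<in>W. \<forall>j. \<not> coord_equiv W i j \<longrightarrow> \<bar>x $ j\<bar> < \<bar>x $ i\<bar>)"

lemma coord_equiv_refl: "coord_equiv W i i"
  unfolding coord_equiv_def by auto

lemma coord_equiv_sym: "coord_equiv W i j \<Longrightarrow> coord_equiv W j i"
  unfolding coord_equiv_def by fastforce

lemma coord_equiv_trans: "coord_equiv W i j \<Longrightarrow> coord_equiv W j k \<Longrightarrow> coord_equiv W i k"
  unfolding coord_equiv_def by fastforce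

lemma coord_equiv_abs: "coord_equiv W i j \<Longrightarrow> x \<in> W \<Longrightarrow> \<bar>x $ j\<bar> = \<bar>x $ i\<bar>"
  unfolding coord_equiv_def by auto

section \<open>The peaking coordinates determine the norm\<close>

lemma eventually_abs_add_small:
  fixes u v :: real
  assumes "u \<noteq> 0"
  shows "\<forall>\<^sub>F e in at_right 0. \<bar>u + e * v\<bar> = \<bar>u\<bar> + e * (sgn u * v)"
proof -
  have lim: "((\<lambda>e. sgn u * (u + e * v)) \<longlongrightarrow> sgn u * (u + 0 * v)) (at_right 0)"
    by (intro tendsto_intros)
  have "sgn u * (u + 0 * v) > 0"
    using assms by (simp add: sgn_if)
  then have "\<forall>\<^sub>F e in at_right 0. sgn u * (u + e * v) > 0"
    using lim order_tendstoD(1) by blast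
  then show ?thesis
    by eventually_elim (use assms in \<open>auto simp: sgn_if algebra_simps split: if_splits\<close>)
qed

text \<open>
  Non-maximality of a coordinate is a strict inequality between continuous functions, so it survives
  small perturbations.
\<close>

lemma active_perturb:
  fixes y z :: "real ^ 'n::finite"
  shows "\<forall>\<^sub>F e in at_right 0. active (y + e *\<^sub>R z) \<subseteq> active y"
proof -
  have "\<forall>\<^sub>F e in at_right 0. j \<notin> active y \<longrightarrow> j \<notin> active (y + e *\<^sub>R z)" for j
  proof (cases "j \<in> active y")
    case False
    have "((\<lambda>e. infnorm (y + e *\<^sub>R z) - \<bar>(y + e *\<^sub>R z) $ j\<bar>)
        \<longlongrightarrow> infnorm (y + 0 *\<^sub>R z) - \<bar>(y + 0 *\<^sub>R z) $ j\<bar>) (at_right 0)"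
      by (intro tendsto_intros tendsto_infnorm)
    moreover have "infnorm (y + 0 *\<^sub>R z) - \<bar>(y + 0 *\<^sub>R z) $ j\<bar> > 0"
      using not_active_less[OF False] by simp
    ultimately have "\<forall>\<^sub>F e in at_right 0. infnorm (y + e *\<^sub>R z) - \<bar>(y + e *\<^sub>R z) $ j\<bar> > 0"
      using order_tendstoD(1) by blast
    then show ?thesis
      by eventually_elim (auto simp: active_def)
  qed simp
  then have "\<forall>\<^sub>F e in at_right 0. \<forall>j. j \<notin> active y \<longrightarrow> j \<notin> active (y + e *\<^sub>R z)"
    by (rule eventually_all_finite)
  then show ?thesis
    by eventually_elim auto
qed

text \<open>
  Among the nonzero vectors of \<open>W\<close> whose active coordinates are active for \<open>x\<close>, one with the fewest
  active coordinates is a peaking vector: if it had two inequivalent active coordinates, moving it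
  slightly in a direction that tells them apart would make one of them inactive.
\<close>

lemma norm_attained_at_peaking:
  fixes W :: "(real ^ 'n::finite) set"
  assumes W: "subspace W" and x: "x \<in> W" "x \<noteq> 0"
  shows "\<exists>i. peaking W i \<and> \<bar>x $ i\<bar> = infnorm x"
proof -
  let ?C = "\<lambda>y. y \<in> W \<and> y \<noteq> 0 \<and> active y \<subseteq> active x"
  obtain y where y: "y \<in> W" "y \<noteq> 0" "active y \<subseteq> active x"
    and min: "\<And>u. ?C u \<Longrightarrow> card (active y) \<le> card (active u)"
    using ex_has_least_nat[of ?C x "\<lambda>y. card (active y)"] x by auto
  obtain i where i: "i \<in> active y"
    using active_nonempty by blast
  have equiv: "coord_equiv W i j" if j: "j \<in> active y" for j
  proof (rule ccontr)
    assume n: "\<not> coord_equiv W i j"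
    have pos: "infnorm y > 0"
      using y(2) by (simp add: infnorm_pos_lt)
    have nz: "y $ i \<noteq> 0" "y $ j \<noteq> 0" "\<bar>y $ i\<bar> = \<bar>y $ j\<bar>"
      using i j pos unfolding active_def by auto
    \<comment> \<open>To first order \<open>\<bar>y $ i\<bar>\<close> and \<open>\<bar>y $ j\<bar>\<close> grow at the rates \<open>sgn (y $ i) * z $ i\<close> and
      \<open>sgn (y $ j) * z $ j\<close>; inequivalence supplies a direction \<open>z\<close> in which these rates differ.\<close>
    have "sgn (y $ j) * sgn (y $ i) \<in> {1, -1}"
      using nz by (auto simp: sgn_if)
    then obtain z where z: "z \<in> W" "z $ j \<noteq> sgn (y $ j) * sgn (y $ i) * z $ i"
      using n unfolding coord_equiv_def by blast
    have zne: "sgn (y $ i) * z $ i \<noteq> sgn (y $ j) * z $ j"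
      using z(2) nz by (auto simp: sgn_if split: if_splits)
    have "((\<lambda>e. infnorm (y + e *\<^sub>R z)) \<longlongrightarrow> infnorm (y + 0 *\<^sub>R z)) (at_right 0)"
      by (intro tendsto_intros tendsto_infnorm)
    then have "\<forall>\<^sub>F e in at_right 0. infnorm (y + e *\<^sub>R z) > 0"
      using pos order_tendstoD(1) by fastforce
    moreover have "\<forall>\<^sub>F e in at_right (0::real). e > 0"
      by (simp add: eventually_at_right_less)
    ultimately have "\<forall>\<^sub>F e in at_right 0. y + e *\<^sub>R z \<noteq> 0 \<and> active (y + e *\<^sub>R z) \<subset> active y"
      using active_perturb[of y z] eventually_abs_add_small[OF nz(1), of "z $ i"]
        eventually_abs_add_small[OF nz(2), of "z $ j"]
    proof eventually_elim
      case (elim e)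
      have "\<bar>(y + e *\<^sub>R z) $ i\<bar> \<noteq> \<bar>(y + e *\<^sub>R z) $ j\<bar>"
        using elim zne nz(3) by simp
      then have "i \<notin> active (y + e *\<^sub>R z) \<or> j \<notin> active (y + e *\<^sub>R z)"
        unfolding active_def by auto
      moreover have "y + e *\<^sub>R z \<noteq> 0"
        using elim(1) infnorm_0 by (metis less_irrefl)
      ultimately show ?case
        using elim(3) i j by blast
    qed
    then obtain e where e: "y + e *\<^sub>R z \<noteq> 0" "active (y + e *\<^sub>R z) \<subset> active y"
      using eventually_happens'[OF trivial_limit_at_right_real] by blast
    have "y + e *\<^sub>R z \<in> W"
      using W y(1) z(1) by (simp add: subspace_add subspace_scale)
    then have "card (active y) \<le> card (active (y + e *\<^sub>R z))"
      using min e y(3) by blast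
    moreover have "card (active (y + e *\<^sub>R z)) < card (active y)"
      using e(2) by (simp add: psubset_card_mono)
    ultimately show False by simp
  qed
  have "peaking W i"
    unfolding peaking_def
  proof (intro bexI allI impI)
    fix j assume "\<not> coord_equiv W i j"
    then have "\<bar>y $ j\<bar> < infnorm y"
      using equiv not_active_less by blast
    then show "\<bar>y $ j\<bar> < \<bar>y $ i\<bar>"
      using i unfolding active_def by simp
  qed (rule y(1))
  then show ?thesis
    using i y(3) unfolding active_def by blast
qed

definition peak_vector :: "(real ^ 'n::finite) set \<Rightarrow> 'n \<Rightarrow> real ^ 'n \<Rightarrow> bool"
  where "peak_vector W i x \<longleftrightarrow>
    x \<in> W \<and> x $ i = 1 \<and> infnorm x = 1 \<and> (\<forall>j. \<bar>x $ j\<bar> = 1 \<longrightarrow> coord_equiv W i j)"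

text \<open>
  A vector witnessing that \<open>i\<close> is peaking can be scaled to \<open>x $ i = 1\<close> unless \<open>x $ i = 0\<close>.  This can
  only happen when all coordinates are equivalent to \<open>i\<close>, and then any nonzero vector of \<open>W\<close> serves.
\<close>

lemma peaking_obtains_peak_vector:
  fixes W :: "(real ^ 'n::finite) set"
  assumes W: "subspace W" and ne: "W \<noteq> {0}" and p: "peaking W i"
  obtains x where "peak_vector W i x"
proof -
  obtain w where w: "w \<in> W" and less: "\<And>j. \<not> coord_equiv W i j \<Longrightarrow> \<bar>w $ j\<bar> < \<bar>w $ i\<bar>"
    using p unfolding peaking_def by blast
  obtain u where u: "u \<in> W" "u $ i \<noteq> 0" "\<And>j. \<not> coord_equiv W i j \<Longrightarrow> \<bar>u $ j\<bar> < \<bar>u $ i\<bar>"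
  proof (cases "\<forall>j. coord_equiv W i j")
    case True
    obtain v where v: "v \<in> W" "v \<noteq> 0"
      using ne W subspace_0 by blast
    then obtain j where "v $ j \<noteq> 0"
      by (metis vec_eq_iff zero_index)
    then have "v $ i \<noteq> 0"
      using coord_equiv_abs[of W i j v] True v(1) by auto
    then show ?thesis using that True v(1) by blast
  next
    case False
    then have "w $ i \<noteq> 0" using less by fastforce
    then show ?thesis using that w less by blast
  qed
  define x where "x = (1 / u $ i) *\<^sub>R u"
  have xW: "x \<in> W"
    unfolding x_def using W u(1) by (simp add: subspace_scale)
  have xi: "x $ i = 1"
    unfolding x_def using u(2) by simp
  have out: "\<bar>x $ j\<bar> < 1" if "\<not> coord_equiv W i j" for j
    unfolding x_def using u(2) u(3)[OF that] by (simp add: abs_mult field_simps)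
  have "\<bar>x $ j\<bar> \<le> 1" for j
    using out[of j] coord_equiv_abs[of W i j x] xW xi by fastforce
  then have "infnorm x \<le> 1"
    by (simp add: infnorm_le_iff_coordinates)
  moreover have "infnorm x \<ge> 1"
    using component_le_infnorm_cart[of x i] xi by simp
  ultimately have "infnorm x = 1" by simp
  then have "peak_vector W i x"
    unfolding peak_vector_def using xW xi out by fastforce
  then show ?thesis using that by blast
qed

section \<open>Facets\<close>

definition peak_face :: "(real ^ 'n::finite) set \<Rightarrow> 'n \<Rightarrow> real \<Rightarrow> (real ^ 'n) set"
  where "peak_face W i \<sigma> = {x \<in> unit_ball_max W. \<sigma> * x $ i = 1}"

lemma signed_coordinate_le:
  fixes x :: "real ^ 'n::finite"
  assumes "\<sigma> \<in> {1, -1}"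
  shows "\<sigma> * x $ i \<le> infnorm x"
  using component_le_infnorm_cart[of x i] assms by auto

lemma peak_vector_in_peak_face:
  assumes W: "subspace W" and x: "peak_vector W i x" and s: "\<sigma> \<in> {1, -1}"
  shows "\<sigma> *\<^sub>R x \<in> peak_face W i \<sigma>"
  using assms subspace_scale[OF W, of x \<sigma>]
  by (auto simp: peak_face_def unit_ball_max_def peak_vector_def infnorm_mul)

lemma proper_face_peak_face:
  assumes W: "subspace W" and ne: "W \<noteq> {0}" and p: "peaking W i" and s: "\<sigma> \<in> {1, -1}"
  shows "proper_face W (peak_face W i \<sigma>)"
proof -
  obtain x where x: "peak_vector W i x"
    using peaking_obtains_peak_vector[OF W ne p] .
  have "linear_map_on W (\<lambda>x. \<sigma> * x $ i)"
    unfolding linear_map_on_def by (auto simp: algebra_simps)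
  moreover have "x \<in> W" "\<sigma> * x $ i \<noteq> 0"
    using x s unfolding peak_vector_def by auto
  moreover have "unit_ball_max W \<subseteq> {x \<in> W. \<sigma> * x $ i \<le> 1}"
    using signed_coordinate_le[OF s] unfolding unit_ball_max_def by (auto intro: order_trans)
  moreover have "peak_face W i \<sigma> = unit_ball_max W \<inter> {x \<in> W. \<sigma> * x $ i = 1}"
    unfolding peak_face_def unit_ball_max_def by auto
  moreover have "peak_face W i \<sigma> \<noteq> {}"
    using peak_vector_in_peak_face[OF W x s] by blast
  ultimately show ?thesis
    unfolding proper_face_def by blast
qed

lemma proper_face_midpoint:
  assumes W: "subspace W" and G: "proper_face W G" and xy: "x \<in> G" "y \<in> G"
  shows "(1/2) *\<^sub>R (x + y) \<in> G"
proof -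
  obtain f :: "_ \<Rightarrow> real" and c where f: "linear_map_on W f" "G = unit_ball_max W \<inter> {x \<in> W. f x = c}"
    using G unfolding proper_face_def by blast
  have mem: "x \<in> W" "y \<in> W" "infnorm x \<le> 1" "infnorm y \<le> 1" "f x = c" "f y = c"
    using xy unfolding f(2) unit_ball_max_def by auto
  have "x + y \<in> W" using mem W by (simp add: subspace_add)
  moreover from this have "(1/2) *\<^sub>R (x + y) \<in> W" using W by (rule subspace_scale[rotated])
  moreover have "f ((1/2) *\<^sub>R (x + y)) = c"
    using f(1) mem calculation unfolding linear_map_on_def by simp
  moreover have "infnorm ((1/2) *\<^sub>R (x + y)) \<le> 1"
    using infnorm_triangle[of x y] mem unfolding infnorm_mul by simp
  ultimately show ?thesis
    unfolding f(2) unit_ball_max_def by simp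
qed

text \<open>
  The supporting form \<open>f\<close> satisfies \<open>f y \<le> c * infnorm y\<close> by homogeneity, and \<open>c > 0\<close> because \<open>f\<close>
  takes values of both signs on \<open>W\<close>.  So \<open>f x = c\<close> is impossible in the interior of the ball.
\<close>

lemma proper_face_infnorm_eq_1:
  assumes W: "subspace W" and G: "proper_face W G" and x: "x \<in> G"
  shows "x \<in> W" "infnorm x = 1"
proof -
  obtain f :: "_ \<Rightarrow> real" and c where f: "linear_map_on W f" "\<exists>x\<in>W. f x \<noteq> 0"
    "unit_ball_max W \<subseteq> {x \<in> W. f x \<le> c}" "G = unit_ball_max W \<inter> {x \<in> W. f x = c}"
    using G unfolding proper_face_def by blast
  show xW: "x \<in> W" using x f(4) by simp
  have bound: "f y \<le> c * infnorm y" if y: "y \<in> W" for y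
  proof (cases "y = 0")
    case True
    have "f (0 *\<^sub>R y) = 0 *\<^sub>R f y"
      using f(1) y unfolding linear_map_on_def by blast
    then show ?thesis using True by (simp add: infnorm_0)
  next
    case False
    then have pos: "infnorm y > 0" by (simp add: infnorm_pos_lt)
    have "(1 / infnorm y) *\<^sub>R y \<in> unit_ball_max W"
      using y pos W by (simp add: unit_ball_max_def subspace_scale infnorm_mul)
    then have "f ((1 / infnorm y) *\<^sub>R y) \<le> c" using f(3) by blast
    moreover have "f ((1 / infnorm y) *\<^sub>R y) = (1 / infnorm y) *\<^sub>R f y"
      using f(1) y unfolding linear_map_on_def by blast
    ultimately show ?thesis using pos by (simp add: field_simps)
  qed
  obtain w where w: "w \<in> W" "f w \<noteq> 0" using f(2) by blast
  have "f ((-1) *\<^sub>R w) = (-1) *\<^sub>R f w"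
    using f(1) w(1) unfolding linear_map_on_def by blast
  moreover have "(-1) *\<^sub>R w \<in> W" using w(1) W by (rule subspace_scale[rotated])
  ultimately have "- f w \<le> c * infnorm w" "f w \<le> c * infnorm w"
    using bound[of "(-1) *\<^sub>R w"] bound[OF w(1)] by (simp_all add: infnorm_neg)
  then have "0 < c * infnorm w" using w(2) by linarith
  then have "c > 0" using infnorm_pos_le[of w] by (simp add: zero_less_mult_iff)
  moreover have "c \<le> c * infnorm x" "infnorm x \<le> 1"
    using bound[OF xW] x unfolding f(4) unit_ball_max_def by auto
  ultimately show "infnorm x = 1" by simp
qed

text \<open>
  All points of a proper face have norm \<open>1\<close>, and so do their midpoints.  A coordinate is therefore
  active at a midpoint only if it has the same value \<open>\<plusminus>1\<close> at both ends.  Hence a point \<open>x\<close> of the face with the fewest active coordinates shares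
  all of them, with their signs, with every other point of the face, and one of them is peaking.
\<close>

lemma proper_face_subset_peak_face:
  fixes W :: "(real ^ 'n::finite) set"
  assumes W: "subspace W" and G: "proper_face W G"
  shows "\<exists>i. \<exists>\<sigma>\<in>{1, -1}. peaking W i \<and> G \<subseteq> peak_face W i \<sigma>"
proof -
  obtain g where "g \<in> G" using G unfolding proper_face_def by blast
  then obtain x where x: "x \<in> G"
    and min: "\<And>u. u \<in> G \<Longrightarrow> card (active x) \<le> card (active u)"
    using ex_has_least_nat[of "\<lambda>u. u \<in> G" g "\<lambda>u. card (active u)"] by auto
  note inG = proper_face_infnorm_eq_1[OF W G]
  have "x \<noteq> 0" using inG(2)[OF x] by (auto simp: infnorm_0)
  then obtain i where i: "peaking W i" "\<bar>x $ i\<bar> = 1"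
    using norm_attained_at_peaking[OF W inG(1)[OF x]] inG(2)[OF x] by auto
  have "y \<in> peak_face W i (x $ i)" if y: "y \<in> G" for y
  proof -
    let ?m = "(1/2) *\<^sub>R (x + y)"
    have m: "?m \<in> G" using proper_face_midpoint[OF W G x y] .
    have le: "\<bar>x $ j\<bar> \<le> 1" "\<bar>y $ j\<bar> \<le> 1" for j
      using component_le_infnorm_cart[of x j] component_le_infnorm_cart[of y j]
        inG(2)[OF x] inG(2)[OF y] by auto
    have m_active: "\<bar>x $ j\<bar> = 1 \<and> y $ j = x $ j" if "j \<in> active ?m" for j
      using that le[of j] inG(2)[OF m] unfolding active_def by (auto simp: abs_if split: if_splits)
    then have "active ?m \<subseteq> active x"
      using inG(2)[OF x] unfolding active_def by auto
    then have "active ?m = active x"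
      using min[OF m] by (intro card_seteq) auto
    moreover have "i \<in> active x"
      using i(2) inG(2)[OF x] unfolding active_def by simp
    ultimately have "y $ i = x $ i"
      using m_active by blast
    then have "x $ i * y $ i = 1"
      using i(2) by (auto simp: abs_if split: if_splits)
    then show ?thesis
      using inG[OF y] unfolding peak_face_def unit_ball_max_def by simp
  qed
  moreover have "x $ i \<in> {1, -1}" using i(2) by (auto simp: abs_if split: if_splits)
  ultimately show ?thesis using i(1) by blast
qed

text \<open>
  The signed peaking vector \<open>\<sigma> *\<^sub>R x\<close> for \<open>i\<close> lies in the larger face, which forces \<open>\<bar>x $ j\<bar> = 1\<close> and so
  makes \<open>j\<close> equivalent to \<open>i\<close>; its value at \<open>j\<close> then fixes the sign.
\<close>

lemma peak_face_subset_imp_sign: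
  assumes W: "subspace W" and ne: "W \<noteq> {0}" and p: "peaking W i"
    and s: "\<sigma> \<in> {1, -1}" and t: "\<tau> \<in> {1, -1}"
    and sub: "peak_face W i \<sigma> \<subseteq> peak_face W j \<tau>"
  shows "\<forall>y\<in>W. \<tau> * y $ j = \<sigma> * y $ i"
proof -
  obtain x where x: "peak_vector W i x"
    using peaking_obtains_peak_vector[OF W ne p] .
  then have "\<sigma> *\<^sub>R x \<in> peak_face W j \<tau>"
    using peak_vector_in_peak_face[OF W x s] sub by blast
  then have xj: "\<tau> * (\<sigma> * x $ j) = 1" unfolding peak_face_def by simp
  then have "\<bar>x $ j\<bar> = 1" using s t by auto
  then obtain \<rho> where \<rho>: "\<rho> \<in> {1, -1}" "\<And>y. y \<in> W \<Longrightarrow> y $ j = \<rho> * y $ i"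
    using x unfolding peak_vector_def coord_equiv_def by blast
  have "x $ j = \<rho>" using \<rho>(2)[of x] x unfolding peak_vector_def by simp
  then show ?thesis
    using \<rho> xj s t by auto
qed

lemma peak_face_cong:
  assumes "\<forall>y\<in>W. \<tau> * y $ j = \<sigma> * y $ i"
  shows "peak_face W j \<tau> = peak_face W i \<sigma>"
  using assms unfolding peak_face_def unit_ball_max_def by auto

text \<open>
  Each proper face is contained in a peak face, and nested peak faces are equal, so the peak faces
  are exactly the maximal proper faces.
\<close>

lemma facet_iff_peak_face:
  fixes W :: "(real ^ 'n::finite) set"
  assumes W: "subspace W" and ne: "W \<noteq> {0}"
  shows "facet W F \<longleftrightarrow> (\<exists>i. \<exists>\<sigma>\<in>{1, -1}. peaking W i \<and> F = peak_face W i \<sigma>)"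
proof
  assume F: "facet W F"
  then have "proper_face W F" unfolding facet_def by blast
  then obtain i \<sigma> where i: "\<sigma> \<in> {1, -1}" "peaking W i" "F \<subseteq> peak_face W i \<sigma>"
    using proper_face_subset_peak_face[OF W] by metis
  moreover have "proper_face W (peak_face W i \<sigma>)"
    using proper_face_peak_face[OF W ne i(2,1)] .
  ultimately show "\<exists>i. \<exists>\<sigma>\<in>{1, -1}. peaking W i \<and> F = peak_face W i \<sigma>"
    using F unfolding facet_def by metis
next
  assume "\<exists>i. \<exists>\<sigma>\<in>{1, -1}. peaking W i \<and> F = peak_face W i \<sigma>"
  then obtain i \<sigma> where i: "\<sigma> \<in> {1, -1}" "peaking W i" and F: "F = peak_face W i \<sigma>"
    by blast
  have "G = F" if G: "proper_face W G" "F \<subseteq> G" for G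
  proof -
    obtain j \<tau> where j: "\<tau> \<in> {1, -1}" "G \<subseteq> peak_face W j \<tau>"
      using proper_face_subset_peak_face[OF W G(1)] by blast
    then have "peak_face W j \<tau> = F"
      using peak_face_cong[OF peak_face_subset_imp_sign[OF W ne i(2,1) j(1)]] G(2) F by blast
    then show ?thesis using j(2) G(2) by blast
  qed
  then show "facet W F"
    unfolding facet_def using proper_face_peak_face[OF W ne i(2,1)] F by blast
qed

definition peak_transversal :: "(real ^ 'n::finite) set \<Rightarrow> 'n set \<Rightarrow> bool"
  where "peak_transversal W R \<longleftrightarrow>
    (\<forall>i\<in>R. peaking W i) \<and> (\<forall>i. peaking W i \<longrightarrow> (\<exists>j\<in>R. coord_equiv W i j)) \<and>
    (\<forall>i\<in>R. \<forall>j\<in>R. coord_equiv W i j \<longrightarrow> i = j)"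

lemma card_facets:
  fixes W :: "(real ^ 'n::finite) set"
  assumes W: "subspace W" and ne: "W \<noteq> {0}" and R: "peak_transversal W R"
  shows "finite {F. facet W F}" "card {F. facet W F} = 2 * card R"
proof -
  let ?S = "{1, -1 :: real}"
  let ?h = "\<lambda>(i, \<sigma>). peak_face W i \<sigma>"
  have "inj_on ?h (R \<times> ?S)"
  proof (rule inj_onI, clarify)
    fix i \<sigma> j \<tau>
    assume iR: "i \<in> R" and s: "\<sigma> \<in> ?S" and jR: "j \<in> R" and t: "\<tau> \<in> ?S"
      and eq: "peak_face W i \<sigma> = peak_face W j \<tau>"
    have p: "peaking W i" using R iR unfolding peak_transversal_def by blast
    have same: "\<tau> * y $ j = \<sigma> * y $ i" if "y \<in> W" for y
      using peak_face_subset_imp_sign[OF W ne p s t] eq that by blast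
    have "y $ j = (\<tau> * \<sigma>) * y $ i" if "y \<in> W" for y
      using same[OF that] t by auto
    moreover have "\<tau> * \<sigma> \<in> ?S" using s t by auto
    ultimately have "coord_equiv W i j" unfolding coord_equiv_def by blast
    then have ij: "i = j" using R iR jR unfolding peak_transversal_def by blast
    obtain x where "peak_vector W i x"
      using peaking_obtains_peak_vector[OF W ne p] .
    then show "i = j \<and> \<sigma> = \<tau>"
      using same[of x] ij unfolding peak_vector_def by simp
  qed
  moreover have "{F. facet W F} = ?h ` (R \<times> ?S)"
  proof (intro equalityI subsetI)
    fix F assume "F \<in> {F. facet W F}"
    then obtain i \<sigma> where i: "\<sigma> \<in> ?S" "peaking W i" and F: "F = peak_face W i \<sigma>"
      using facet_iff_peak_face[OF W ne] by blast
    then obtain j where j: "j \<in> R" "coord_equiv W i j"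
      using R unfolding peak_transversal_def by blast
    then obtain \<rho> where \<rho>: "\<rho> \<in> ?S" "\<And>y. y \<in> W \<Longrightarrow> y $ j = \<rho> * y $ i"
      unfolding coord_equiv_def by blast
    have "\<forall>y\<in>W. (\<sigma> * \<rho>) * y $ j = \<sigma> * y $ i"
      using \<rho> i(1) by auto
    then have "peak_face W j (\<sigma> * \<rho>) = peak_face W i \<sigma>" by (rule peak_face_cong)
    then have "F = ?h (j, \<sigma> * \<rho>)" using F by simp
    moreover have "\<sigma> * \<rho> \<in> ?S" using i(1) \<rho>(1) by auto
    ultimately show "F \<in> ?h ` (R \<times> ?S)" using j(1) by blast
  next
    fix F assume "F \<in> ?h ` (R \<times> ?S)"
    then obtain i \<sigma> where i: "i \<in> R" "\<sigma> \<in> ?S" and F: "F = peak_face W i \<sigma>"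
      by blast
    have "peaking W i" using R i(1) unfolding peak_transversal_def by blast
    then have "facet W F" using facet_iff_peak_face[OF W ne] i(2) F by metis
    then show "F \<in> {F. facet W F}" by simp
  qed
  moreover have "finite (R \<times> ?S)" by simp
  moreover have "card (R \<times> ?S) = 2 * card R" by (simp add: card_cartesian_product)
  ultimately show "finite {F. facet W F}" "card {F. facet W F} = 2 * card R"
    by (simp_all add: card_image del: finite_SigmaI)
qed

section \<open>Embeddings\<close>

text \<open>
  For small \<open>e > 0\<close> the active coordinates of \<open>x + e *\<^sub>R y\<close> are all equivalent to \<open>i\<close>, so its norm is
  \<open>1 + e * y $ i\<close>.  Comparing with \<open>\<phi> (x + e *\<^sub>R y) = 1 + e * \<phi> y\<close> gives the bound.
\<close>

lemma functional_le_coordinate_at_peak: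
  fixes W :: "(real ^ 'n::finite) set" and \<phi> :: "real ^ 'n \<Rightarrow> real"
  assumes W: "subspace W" and lin: "linear_map_on W \<phi>"
    and bound: "\<forall>y\<in>W. \<phi> y \<le> infnorm y"
    and x: "peak_vector W i x" and \<phi>x: "\<phi> x = 1" and y: "y \<in> W"
  shows "\<phi> y \<le> y $ i"
proof -
  have xW: "x \<in> W" "x $ i = 1" "infnorm x = 1" using x unfolding peak_vector_def by auto
  have "\<forall>\<^sub>F e in at_right 0. active (x + e *\<^sub>R y) \<subseteq> active x"
    by (rule active_perturb)
  moreover have "\<forall>\<^sub>F e in at_right 0. \<bar>x $ i + e * y $ i\<bar> = \<bar>x $ i\<bar> + e * (sgn (x $ i) * y $ i)"
    using xW(2) by (intro eventually_abs_add_small) simp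
  moreover have "\<forall>\<^sub>F e in at_right (0::real). e > 0"
    by (simp add: eventually_at_right_less)
  ultimately have "\<forall>\<^sub>F e in at_right 0. 0 < e \<and> e * \<phi> y \<le> e * y $ i"
  proof eventually_elim
    case (elim e)
    let ?u = "x + e *\<^sub>R y"
    have eW: "e *\<^sub>R y \<in> W" using W y by (rule subspace_scale)
    then have uW: "?u \<in> W" using W xW(1) by (simp add: subspace_add)
    obtain j where j: "j \<in> active ?u" using active_nonempty by blast
    then have "coord_equiv W i j"
      using elim(1) x xW(3) unfolding active_def peak_vector_def by auto
    then have "infnorm ?u = \<bar>?u $ i\<bar>"
      using coord_equiv_abs uW j unfolding active_def by fastforce
    also have "\<dots> = 1 + e * y $ i" using elim(2) xW(2) by simp
    finally have "\<phi> ?u \<le> 1 + e * y $ i" using bound uW by fastforce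
    moreover have "\<phi> ?u = \<phi> x + e * \<phi> y"
      using lin xW(1) eW y unfolding linear_map_on_def by simp
    ultimately show ?case using \<phi>x elim(3) by simp
  qed
  then obtain e :: real where "0 < e" "e * \<phi> y \<le> e * y $ i"
    using eventually_happens'[OF trivial_limit_at_right_real] by blast
  then show ?thesis by simp
qed

text \<open>The one-sided bound, applied to \<open>y\<close> and to its negative.\<close>

lemma functional_eq_coordinate_at_peak:
  fixes W :: "(real ^ 'n::finite) set" and \<phi> :: "real ^ 'n \<Rightarrow> real"
  assumes W: "subspace W" and lin: "linear_map_on W \<phi>"
    and bound: "\<forall>y\<in>W. \<phi> y \<le> infnorm y"
    and x: "peak_vector W i x" and \<phi>x: "\<phi> x = 1" and y: "y \<in> W"
  shows "\<phi> y = y $ i"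
proof -
  note le = functional_le_coordinate_at_peak[OF W lin bound x \<phi>x]
  have "(-1) *\<^sub>R y \<in> W" using W y by (rule subspace_scale)
  then have "\<phi> ((-1) *\<^sub>R y) \<le> ((-1) *\<^sub>R y) $ i" by (rule le)
  moreover have "\<phi> ((-1) *\<^sub>R y) = (-1) *\<^sub>R \<phi> y"
    using lin y unfolding linear_map_on_def by blast
  ultimately show ?thesis using le[OF y] by simp
qed

text \<open>
  Every target coordinate of an isometry \<open>f\<close> is a form bounded by the norm, and at a peaking vector
  for \<open>i\<close> one of them has value \<open>\<plusminus>1\<close>.  By rigidity that target coordinate is \<open>\<plusminus>\<close> the coordinate
  \<open>i\<close>, so inequivalent peaking coordinates need different target coordinates.
\<close>

lemma embeds_linf_imp_card_le:
  fixes W :: "(real ^ 'n::finite) set"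
  assumes W: "subspace W" and ne: "W \<noteq> {0}" and R: "peak_transversal W R"
    and emb: "embeds_linf W TYPE('s::finite)"
  shows "card R \<le> CARD('s)"
proof -
  obtain f :: "real ^ 'n \<Rightarrow> real ^ 's" where lin: "linear_map_on W f"
    and iso: "\<And>x. x \<in> W \<Longrightarrow> infnorm (f x) = infnorm x"
    using emb unfolding embeds_linf_def linear_isometry_on_def by blast
  have ex: "\<exists>t. \<exists>\<tau>\<in>{1, -1}. \<forall>y\<in>W. \<tau> * f y $ t = y $ i" if "i \<in> R" for i
  proof -
    have "peaking W i" using R that unfolding peak_transversal_def by blast
    then obtain x where x: "peak_vector W i x"
      using peaking_obtains_peak_vector[OF W ne] by blast
    then have "infnorm (f x) = 1" using iso unfolding peak_vector_def by simp
    then obtain t where t: "\<bar>f x $ t\<bar> = 1" using infnorm_attained by metis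
    let ?\<tau> = "f x $ t"
    have \<tau>: "?\<tau> \<in> {1, -1}" using t by (auto simp: abs_if split: if_splits)
    have "?\<tau> * f y $ t = y $ i" if "y \<in> W" for y
    proof (rule functional_eq_coordinate_at_peak[OF W _ _ x _ that])
      show "linear_map_on W (\<lambda>y. ?\<tau> * f y $ t)"
        using lin unfolding linear_map_on_def by (auto simp: algebra_simps)
      show "\<forall>y\<in>W. ?\<tau> * f y $ t \<le> infnorm y"
        using signed_coordinate_le[OF \<tau>] iso by metis
      show "?\<tau> * f x $ t = 1" using \<tau> by auto
    qed
    then show ?thesis using \<tau> by blast
  qed
  then obtain q where q: "\<And>i. i \<in> R \<Longrightarrow> \<exists>\<tau>\<in>{1, -1}. \<forall>y\<in>W. \<tau> * f y $ q i = y $ i"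
    by metis
  have "inj_on q R"
  proof (rule inj_onI)
    fix i j assume ij: "i \<in> R" "j \<in> R" "q i = q j"
    obtain \<sigma> where s: "\<sigma> \<in> {1, -1}" "\<forall>y\<in>W. \<sigma> * f y $ q i = y $ i"
      using q[OF ij(1)] by blast
    obtain \<tau> where t: "\<tau> \<in> {1, -1}" "\<forall>y\<in>W. \<tau> * f y $ q j = y $ j"
      using q[OF ij(2)] by blast
    have "\<forall>y\<in>W. y $ j = (\<tau> * \<sigma>) * y $ i"
      using s t ij(3) by auto
    moreover have "\<tau> * \<sigma> \<in> {1, -1}" using s(1) t(1) by auto
    ultimately have "coord_equiv W i j" unfolding coord_equiv_def by blast
    then show "i = j" using R ij unfolding peak_transversal_def by blast
  qed
  then show ?thesis
    using card_inj_on_le[of q R UNIV] by simp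
qed

definition select_coords :: "'n set \<Rightarrow> ('n \<Rightarrow> 's) \<Rightarrow> real ^ 'n::finite \<Rightarrow> real ^ 's::finite"
  where "select_coords R g x = (\<chi> t. if t \<in> g ` R then x $ inv_into R g t else 0)"

lemma linear_select_coords: "linear (select_coords R g)"
  unfolding select_coords_def by (rule linearI) (auto simp: vec_eq_iff)

lemma infnorm_select_coords:
  fixes W :: "(real ^ 'n::finite) set" and g :: "'n \<Rightarrow> 's::finite"
  assumes W: "subspace W" and R: "peak_transversal W R" and g: "inj_on g R" and x: "x \<in> W"
  shows "infnorm (select_coords R g x) = infnorm x"
proof (cases "x = 0")
  case True
  then show ?thesis
    by (simp add: linear_0[OF linear_select_coords] infnorm_0)
next
  case False
  have "\<bar>select_coords R g x $ t\<bar> \<le> infnorm x" for t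
    using component_le_infnorm_cart[of x] infnorm_pos_le[of x] unfolding select_coords_def by auto
  then have "infnorm (select_coords R g x) \<le> infnorm x"
    by (simp add: infnorm_le_iff_coordinates)
  moreover obtain i where i: "peaking W i" "\<bar>x $ i\<bar> = infnorm x"
    using norm_attained_at_peaking[OF W x False] by blast
  then obtain j where j: "j \<in> R" "coord_equiv W i j"
    using R unfolding peak_transversal_def by blast
  have "\<bar>select_coords R g x $ g j\<bar> = infnorm x"
    using j i coord_equiv_abs[OF j(2) x] g unfolding select_coords_def by simp
  then have "infnorm x \<le> infnorm (select_coords R g x)"
    using component_le_infnorm_cart by metis
  ultimately show ?thesis by simp
qed

lemma linear_isometry_on_select_coords:
  fixes W :: "(real ^ 'n::finite) set" and g :: "'n \<Rightarrow> 's::finite"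
  assumes "subspace W" and "peak_transversal W R" and "inj_on g R"
  shows "linear_isometry_on W (select_coords R g)"
  using infnorm_select_coords[OF assms] linear_select_coords[of R g]
  unfolding linear_isometry_on_def linear_map_on_def
  by (auto simp: linear_add linear_scale)

lemma embeds_linf_iff_card_le:
  fixes W :: "(real ^ 'n::finite) set"
  assumes W: "subspace W" and ne: "W \<noteq> {0}" and R: "peak_transversal W R"
  shows "embeds_linf W TYPE('s::finite) \<longleftrightarrow> card R \<le> CARD('s)"
proof
  assume "card R \<le> CARD('s)"
  then obtain g :: "'n \<Rightarrow> 's" where "inj_on g R"
    using card_le_inj[of R "UNIV :: 's set"] by auto
  then show "embeds_linf W TYPE('s)"
    using linear_isometry_on_select_coords[OF W R] unfolding embeds_linf_def by blast
qed (rule embeds_linf_imp_card_le[OF W ne R])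

text \<open>An isometry is injective, so its image has the full dimension \<open>CARD('m)\<close>.\<close>

lemma select_coords_surj:
  fixes W :: "(real ^ 'n::finite) set" and g :: "'n \<Rightarrow> 'm::finite"
  assumes W: "subspace W" and R: "peak_transversal W R" and g: "inj_on g R"
    and dim: "dim W = CARD('m)"
  shows "select_coords R g ` W = UNIV"
proof -
  let ?f = "select_coords R g"
  have "x = 0" if "x \<in> W" "?f x = 0" for x
    using infnorm_select_coords[OF W R g that(1)] that(2) by (simp add: infnorm_0 infnorm_eq_0)
  then have "inj_on ?f (span W)"
    using linear_inj_on_iff_eq_0[OF linear_select_coords] W
    by (metis span_eq_iff)
  then have "dim (?f ` W) = CARD('m)"
    using dim_image_eq[OF linear_select_coords] dim by metis
  moreover have "subspace (?f ` W)"
    using linear_subspace_image[OF linear_select_coords W] .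
  ultimately show ?thesis
    by (metis DIM_cart DIM_real dim_eq_full mult.right_neutral span_eq_iff)
qed

lemma isometric_linf_iff_card_eq:
  fixes W :: "(real ^ 'n::finite) set"
  assumes W: "subspace W" and ne: "W \<noteq> {0}" and R: "peak_transversal W R"
    and dim: "dim W = CARD('m::finite)"
  shows "isometric_linf W TYPE('m) \<longleftrightarrow> card R = CARD('m)"
proof
  assume "isometric_linf W TYPE('m)"
  then have "embeds_linf W TYPE('m)"
    unfolding isometric_linf_def embeds_linf_def by blast
  then have le: "card R \<le> CARD('m)"
    using embeds_linf_iff_card_le[OF W ne R] by blast
  then obtain g :: "'n \<Rightarrow> 'm" where g: "inj_on g R"
    using card_le_inj[of R "UNIV :: 'm set"] by auto
  \<comment> \<open>A target coordinate outside \<open>g ` R\<close> would vanish on the whole image, which is everything.\<close>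
  have "t \<in> g ` R" for t
  proof -
    obtain x where "axis t 1 = select_coords R g x"
      using select_coords_surj[OF W R g dim] by (metis UNIV_I imageE)
    then have "select_coords R g x $ t = 1" by (metis axis_nth)
    then show ?thesis unfolding select_coords_def by (auto split: if_splits)
  qed
  then have "g ` R = UNIV" by blast
  then show "card R = CARD('m)" using card_image[OF g] by simp
next
  assume "card R = CARD('m)"
  then obtain g :: "'n \<Rightarrow> 'm" where g: "inj_on g R"
    using card_le_inj[of R "UNIV :: 'm set"] by auto
  then show "isometric_linf W TYPE('m)"
    using linear_isometry_on_select_coords[OF W R g] select_coords_surj[OF W R g dim]
    unfolding isometric_linf_def by blast
qed

section \<open>Components of a basis\<close>

lemma component_sign_iff:
  fixes a :: "'m::finite \<Rightarrow> real ^ 'n::finite"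
  shows "component a j = \<rho> *\<^sub>R component a i \<longleftrightarrow> (\<forall>x\<in>span (range a). x $ j = \<rho> * x $ i)"
proof
  assume eq: "component a j = \<rho> *\<^sub>R component a i"
  have "subspace {x :: real ^ 'n. x $ j = \<rho> * x $ i}"
    by (auto simp: subspace_def algebra_simps)
  moreover have "range a \<subseteq> {x. x $ j = \<rho> * x $ i}"
    using eq by (auto simp: component_def vec_eq_iff)
  ultimately show "\<forall>x\<in>span (range a). x $ j = \<rho> * x $ i"
    using span_minimal by blast
next
  assume "\<forall>x\<in>span (range a). x $ j = \<rho> * x $ i"
  then show "component a j = \<rho> *\<^sub>R component a i"
    by (auto simp: component_def vec_eq_iff intro: span_base)
qed

lemma equiv_components_eq:
  "equiv_components a i = {j. coord_equiv (span (range a)) i j}"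
  using component_sign_iff[of a _ 1 i] component_sign_iff[of a _ "-1" i]
  unfolding equiv_components_def coord_equiv_def by auto

lemma span_range_eq:
  fixes a :: "'m::finite \<Rightarrow> real ^ 'n::finite"
  shows "span (range a) = range (\<lambda>\<beta> :: real ^ 'm. \<Sum>k\<in>UNIV. \<beta> $ k *\<^sub>R a k)"
proof
  show "range (\<lambda>\<beta> :: real ^ 'm. \<Sum>k\<in>UNIV. \<beta> $ k *\<^sub>R a k) \<subseteq> span (range a)"
    by (auto intro: span_sum span_scale span_base)
  have "subspace (range (\<lambda>\<beta> :: real ^ 'm. \<Sum>k\<in>UNIV. \<beta> $ k *\<^sub>R a k))"
    by (intro linear_subspace_image subspace_UNIV linearI)
      (auto simp: scaleR_add_left sum.distrib scaleR_sum_right)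
  moreover have "a k \<in> range (\<lambda>\<beta> :: real ^ 'm. \<Sum>k\<in>UNIV. \<beta> $ k *\<^sub>R a k)" for k
  proof
    show "a k = (\<Sum>l\<in>UNIV. axis k 1 $ l *\<^sub>R a l)"
      by (simp add: axis_def if_distrib[where f = "\<lambda>c. c *\<^sub>R _"] cong: if_cong)
  qed simp
  ultimately show "span (range a) \<subseteq> range (\<lambda>\<beta> :: real ^ 'm. \<Sum>k\<in>UNIV. \<beta> $ k *\<^sub>R a k)"
    by (intro span_minimal) auto
qed

lemma star_property_iff_peaking:
  "star_property a i \<longleftrightarrow> peaking (span (range a)) i"
  unfolding star_property_def peaking_def equiv_components_eq span_range_eq
  by (auto simp: sum_component)

text \<open>
  Choosing one index in each class turns the count of classes into the size of a transversal, the
  form in which the geometric results are stated.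
\<close>

lemma num_star_components_transversal:
  fixes a :: "'m::finite \<Rightarrow> real ^ 'n::finite"
  obtains R where "peak_transversal (span (range a)) R" "card R = num_star_components a"
proof -
  let ?W = "span (range a)" and ?P = "{i. star_property a i}"
  obtain R where R: "R \<subseteq> ?P" "inj_on (equiv_components a) R"
    "equiv_components a ` ?P = equiv_components a ` R"
    using subset_image_inj[of "equiv_components a ` ?P" "equiv_components a" ?P] by auto
  have same: "coord_equiv ?W i j \<longleftrightarrow> equiv_components a i = equiv_components a j" for i j
    unfolding equiv_components_eq
    using coord_equiv_refl coord_equiv_sym coord_equiv_trans by blast
  have "peak_transversal ?W R"
    unfolding peak_transversal_def same
  proof (intro conjI ballI allI impI)
    show "peaking ?W i" if "i \<in> R" for i
      using that R(1) star_property_iff_peaking by blast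
    show "\<exists>j\<in>R. equiv_components a i = equiv_components a j" if "peaking ?W i" for i
    proof -
      have "equiv_components a i \<in> equiv_components a ` R"
        using that R(3) star_property_iff_peaking by blast
      then show ?thesis by blast
    qed
    show "i = j" if "i \<in> R" "j \<in> R" "equiv_components a i = equiv_components a j" for i j
      using that R(2) by (simp add: inj_on_eq_iff)
  qed
  moreover have "card R = num_star_components a"
    unfolding num_star_components_def R(3) using R(2) by (simp add: card_image)
  ultimately show ?thesis using that by blast
qed

theorem theorem2p8:
  fixes W :: "(real ^ 'n::finite) set"
    and a :: "'m::finite \<Rightarrow> real ^ 'n"
    and r :: nat
  assumes "subspace W"
    and "dim W = CARD('m)"
    and "inj a" and "independent (range a)" and "span (range a) = W"
    and "num_star_components a = r"
  shows "(finite {F. facet W F} \<and> card {F. facet W F} = 2 * r)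
    \<and> (embeds_linf W TYPE('s::finite) \<longleftrightarrow> r \<le> CARD('s))
    \<and> (isometric_linf W TYPE('m) \<longleftrightarrow> r = CARD('m))"
proof -
  obtain R where R: "peak_transversal W R" "card R = r"
    using num_star_components_transversal[of a] assms(5,6) by metis
  have ne: "W \<noteq> {0}"
    using assms(2) by auto
  show ?thesis
    using card_facets[OF assms(1) ne R(1)] embeds_linf_iff_card_le[OF assms(1) ne R(1)]
      isometric_linf_iff_card_eq[OF assms(1) ne R(1) assms(2)] R(2)
    by simp
qed

end
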